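(* Let $n\ge 1$, let $f_1,\dots,f_n:\mathsf H\to\mathbb R$ be functions on a separable real Hilbert space $\mathsf H$, let $F=\frac1n\sum_{i=1}^n f_i$, and assume $\operatorname{argmin}F\neq\varnothing$. Assume that each $f_i$ is convex and $L$-smooth for some $L>0$, and that $F$ satisfies the Polyak–Łojasiewicz condition with constant $\mu>0$: $F(x)-F_*\le\frac1{2\mu}\|\nabla F(x)\|^2$ for all $x\in\mathsf H$. Let $(\boldsymbol x^k)_{k\in\mathbb N}$ be generated by the SAPA algorithm described in the context with step size $\alpha$. Let $M>2n$ and let $\alpha>0$ be such that $\alpha<\frac1{L(2+M/n)}$. Set $$q=\max\Big\{1-\alpha\mu\big(1-\alpha L(2+M/n)\big),\;1+\frac2M-\frac1n\Big\}.$$ Then $q\in\,]0,1[$ and for all $k\in\mathbb N$, $$\mathsf E[\operatorname{dist}(\boldsymbol x^k,\operatorname{argmin}F)^2]\le q^k\big(\operatorname{dist}(\boldsymbol x^0,\operatorname{argmin}F)^2+\alpha^2M\,\mathsf E[\sigma_0^2]\big),$$ $$\mathsf E[F(\boldsymbol x^k)-F_*]\le\frac{q^kL}2\big(\operatorname{dist}(\boldsymbol x^0,\operatorname{argmin}F)^2+\alpha^2M\,\mathsf E[\sigma_0^2]\big),$$ where $\sigma_0^2=\frac1n\sum_{i=1}^n\|\nabla f_i(\boldsymbol\phi_i^0)-\nabla f_i(\boldsymbol x^* )\|^2$ and $\boldsymbol x^*\in\operatorname{argmin}F$ is such that $\|\boldsymbol x^0-\boldsymbol x^*\|=\operatorname{dist}(\boldsymbol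 x^0,\operatorname{argmin}F)$.
   Context: Notation: $F_*=\inf F$; $\operatorname{dist}(x,S)=\inf_{z\in S}\|x-z\|$; $\operatorname{prox}_{\varphi}(x)=\operatorname{argmin}_{y\in\mathsf H}\{\varphi(y)+\frac12\|y-x\|^2\}$; $\delta_{i,j}$ is the Kronecker symbol. A function $f$ is $L$-smooth if it is differentiable and $\|\nabla f(x)-\nabla f(y)\|\le L\|x-y\|$ for all $x,y\in\mathsf H$. SAPA algorithm: $(i_k)_{k\in\mathbb N}$ is a sequence of i.i.d. random variables uniformly distributed on $\{1,\dots,n\}$. Let $\alpha>0$ and set, for every $i\in\{1,\dots,n\}$, $\boldsymbol\phi_i^0=\boldsymbol x^0\in\mathsf H$ (deterministic). For $k=0,1,\dots$ $$\boldsymbol x^{k+1}=\operatorname{prox}_{\alpha f_{i_k}}\Big(\boldsymbol x^k+\alpha\nabla f_{i_k}(\boldsymbol\phi_{i_k}^k)-\frac\alpha n\sum_{i=1}^n\nabla f_i(\boldsymbol\phi_i^k)\Big),\qquad\boldsymbol\phi_i^{k+1}=\boldsymbol\phi_i^k+\delta_{i,i_k}(\boldsymbol x^k-\boldsymbol\phi_i^k)\ \text{ for all } i\in\{1,\dots,n\}.$$ *)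

theory Defs
  imports "HOL-Probability.Probability"
begin

definition argmin :: "('a \<Rightarrow> real) \<Rightarrow> 'a set" where
  "argmin \<phi> = {x. \<forall>y. \<phi> x \<le> \<phi> y}"

text \<open>The minimizer is unique when \<open>\<phi>\<close> is convex and continuous on a Hilbert space;
  \<open>the_elem\<close> turns the singleton \<open>argmin\<close> into its element.\<close>

definition prox :: "('a::real_inner \<Rightarrow> real) \<Rightarrow> 'a \<Rightarrow> 'a" where
  "prox \<phi> x = the_elem (argmin (\<lambda>y. \<phi> y + 1 / 2 * (norm (y - x))\<^sup>2))"

definition grad :: "('a::real_inner \<Rightarrow> real) \<Rightarrow> 'a \<Rightarrow> 'a" where
  "grad \<phi> x = (THE d. GDERIV \<phi> x :> d)"

text \<open>Differentiability is Frechet differentiability; on a Hilbert space it yields the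
  existence of the gradient by the Riesz representation theorem.\<close>

definition L_smooth :: "real \<Rightarrow> ('a::real_inner \<Rightarrow> real) \<Rightarrow> bool" where
  "L_smooth L \<phi> \<longleftrightarrow> (\<forall>x. \<phi> differentiable (at x)) \<and>
     (\<forall>x y. norm (grad \<phi> x - grad \<phi> y) \<le> L * norm (x - y))"

definition polyak_lojasiewicz :: "real \<Rightarrow> ('a::real_inner \<Rightarrow> real) \<Rightarrow> bool" where
  "polyak_lojasiewicz \<mu> F \<longleftrightarrow>
     (\<forall>x. F x - (INF z. F z) \<le> 1 / (2 * \<mu>) * (norm (grad F x))\<^sup>2)"

text \<open>One realization of SAPA: \<open>ix k\<close> is the index drawn at step \<open>k\<close>,
  \<open>x k\<close> the iterate and \<open>\<phi> k i\<close> the point stored for the \<open>i\<close>-th function.\<close>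

definition sapa ::
  "real \<Rightarrow> nat \<Rightarrow> (nat \<Rightarrow> 'a::real_inner \<Rightarrow> real) \<Rightarrow> 'a \<Rightarrow> (nat \<Rightarrow> nat) \<Rightarrow>
    (nat \<Rightarrow> 'a) \<Rightarrow> (nat \<Rightarrow> nat \<Rightarrow> 'a) \<Rightarrow> bool" where
  "sapa \<alpha> n f x0 ix x \<phi> \<longleftrightarrow>
     x 0 = x0 \<and> (\<forall>i\<in>{1..n}. \<phi> 0 i = x0) \<and>
     (\<forall>k. x (Suc k) =
            prox (\<lambda>y. \<alpha> * f (ix k) y)
              (x k + \<alpha> *\<^sub>R grad (f (ix k)) (\<phi> k (ix k))
                   - (\<alpha> / real n) *\<^sub>R (\<Sum>i=1..n. grad (f i) (\<phi> k i))) \<and>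
          (\<forall>i\<in>{1..n}. \<phi> (Suc k) i =
            \<phi> k i + (if i = ix k then 1 else 0) *\<^sub>R (x k - \<phi> k i)))"

end

theory Submission
  imports Defs
begin

text \<open>The Lyapunov function is \<open>dist(x, argmin F)\<^sup>2 + \<alpha>\<^sup>2 M \<sigma>\<^sup>2\<close>, where \<open>\<sigma>\<^sup>2\<close> is the mean squared distance of
  the stored gradients from the gradients at a minimizer. Cocoercivity shows that the latter do not
  depend on the minimizer and bounds the noise of a proximal step by the optimality gap and \<open>\<sigma>\<^sup>2\<close>.
  Averaging over the drawn index, the optimality gap enters the recursion with the coefficient
  \<open>- 2 \<alpha> (1 - \<alpha> L (2 + M / n))\<close>, and quadratic growth converts it into a contraction of the distance.
  Quadratic growth with the sharp constant \<open>\<mu> / 2\<close> follows from the Polyak--Lojasiewicz inequality: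
  gradient descent with step \<open>h\<close> has a path of length at most \<open>sqrt (F x - F\<^sub>*)\<close>, up to a constant
  that tends to \<open>sqrt (2 / \<mu>)\<close> as \<open>h\<close> tends to \<open>0\<close>. Since \<open>\<alpha> L < 1\<close>, the proximal point is the fixed
  point of a contraction. After \<open>k\<close> draws the state takes finitely many values, so every expectation
  is a finite average.\<close>

section \<open>Gradients of smooth convex functions\<close>

text \<open>The representer is the minimizer of \<open>J v = (norm v)\<^sup>2 - 2 * l v\<close>.
  This function is bounded below, its minimizing sequences are Cauchy by the parallelogram law, and
  its first variation at the minimizer is \<open>inner v d - l v\<close> up to a factor 2.\<close>

lemma riesz_representation:
  fixes l :: "'a::{real_inner, complete_space} \<Rightarrow> real"
  assumes l: "bounded_linear l"
  obtains d where "\<And>v. l v = inner v d"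
proof -
  interpret l: bounded_linear l by fact
  define J where "J v = (norm v)\<^sup>2 - 2 * l v" for v
  obtain K where K: "\<And>v. norm (l v) \<le> norm v * K"
    using l.bounded by blast
  have lower: "- K\<^sup>2 \<le> J v" for v
  proof -
    have "0 \<le> (norm v - K)\<^sup>2" by simp
    moreover have "l v \<le> norm v * K" using K[of v] by simp
    ultimately show ?thesis
      by (simp add: J_def power2_diff)
  qed
  have bdd: "bdd_below (range J)"
    by (rule bdd_belowI2[of _ "- K\<^sup>2"]) (rule lower)
  define m where "m = (INF v. J v)"
  have m: "m \<le> J v" for v
    unfolding m_def by (rule cINF_lower[OF bdd]) simp
  have "\<exists>v. J v < m + 1 / real (Suc k)" for k
  proof -
    have "(INF v. J v) < m + 1 / real (Suc k)" by (simp add: m_def)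
    thus ?thesis by (auto simp: cINF_less_iff[OF _ bdd])
  qed
  then obtain u where u: "\<And>k. J (u k) < m + 1 / real (Suc k)" by metis
  \<comment> \<open>Parallelogram law; the linear part of \<open>J\<close> cancels. Two
    near-minimizers are therefore close, since \<open>J\<close> at their midpoint is at least
    \<open>m\<close>.\<close>
  have par: "J a + J b = 2 * J ((1/2) *\<^sub>R (a + b)) + (norm (a - b))\<^sup>2 / 2" for a b
    unfolding J_def by (simp add: l.scaleR l.add power2_norm_eq_inner algebra_simps inner_commute
        add_divide_distrib diff_divide_distrib)
  have near: "(norm (u i - u j))\<^sup>2 \<le> 4 / real (Suc N)" if "i \<ge> N" "j \<ge> N" for i j N
  proof -
    have "1 / real (Suc i) \<le> 1 / real (Suc N)" "1 / real (Suc j) \<le> 1 / real (Suc N)"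
      using that by (auto intro!: divide_left_mono)
    moreover have "(norm (u i - u j))\<^sup>2 / 2 \<le> 1 / real (Suc i) + 1 / real (Suc j)"
      using par[of "u i" "u j"] m[of "(1/2) *\<^sub>R (u i + u j)"] u[of i] u[of j] by linarith
    ultimately show ?thesis by linarith
  qed
  have "Cauchy u"
  proof (rule CauchyI)
    fix e :: real assume e: "e > 0"
    obtain N where N: "4 / e\<^sup>2 < real (Suc N)"
      using reals_Archimedean2 by (metis less_Suc_eq of_nat_less_iff order.strict_trans lessI)
    have "4 / real (Suc N) < e\<^sup>2"
      using N e by (simp add: field_simps del: of_nat_Suc)
    hence "norm (u i - u j) < e" if "i \<ge> N" "j \<ge> N" for i j
      using near[OF that] e by (smt (verit) power2_le_imp_le power_mono norm_ge_zero)
    thus "\<exists>N. \<forall>i\<ge>N. \<forall>j\<ge>N. norm (u i - u j) < e" by blast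
  qed
  then obtain d where d: "u \<longlonglongrightarrow> d"
    using convergent_eq_Cauchy by blast
  have "(\<lambda>k. J (u k)) \<longlonglongrightarrow> J d"
    unfolding J_def by (intro tendsto_intros l.tendsto d)
  moreover have "(\<lambda>k. m + 1 / real (Suc k)) \<longlonglongrightarrow> m + 0"
    using LIMSEQ_inverse_real_of_nat by (intro tendsto_intros) (simp add: inverse_eq_divide)
  ultimately have "J d \<le> m + 0"
    by (rule LIMSEQ_le) (use u less_imp_le in blast)
  hence min: "J d \<le> J v" for v using m[of v] by simp
  have "l v = inner v d" for v
  proof (cases "v = 0")
    case False
    define c where "c = inner v d - l v"
    have exp: "J (d + t *\<^sub>R v) = J d + t\<^sup>2 * (norm v)\<^sup>2 + 2 * t * c" for t
      unfolding J_def c_def power2_norm_eq_inner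
      by (simp add: l.scaleR l.add algebra_simps inner_commute power2_eq_square)
    have nv: "norm v > 0" using False by simp
    \<comment> \<open>\<open>t = - c / (norm v)\<^sup>2\<close> minimizes the quadratic polynomial
      in \<open>exp\<close>; minimality of \<open>d\<close> leaves only
      \<open>c = 0\<close>.\<close>
    have "(- c / (norm v)\<^sup>2)\<^sup>2 * (norm v)\<^sup>2 + 2 * (- c / (norm v)\<^sup>2) * c = - (c\<^sup>2 / (norm v)\<^sup>2)"
      using nv by (simp add: field_simps power2_eq_square)
    hence "c\<^sup>2 / (norm v)\<^sup>2 \<le> 0"
      using exp[of "- c / (norm v)\<^sup>2"] min[of "d + (- c / (norm v)\<^sup>2) *\<^sub>R v"] by linarith
    hence "c = 0" using nv by (simp add: divide_le_0_iff)
    thus ?thesis by (simp add: c_def)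
  qed (simp add: l.zero)
  thus ?thesis using that by blast
qed

lemma GDERIV_unique:
  fixes f :: "'a::real_inner \<Rightarrow> real"
  assumes "GDERIV f x :> d" "GDERIV f x :> e"
  shows "d = e"
proof -
  have "(\<lambda>h. inner h d) = (\<lambda>h. inner h e)"
    using assms unfolding gderiv_def by (rule has_derivative_unique)
  hence "inner (d - e) (d - e) = 0"
    by (metis inner_diff_right right_minus_eq)
  thus ?thesis by simp
qed

lemma GDERIV_imp_grad:
  assumes "GDERIV f x :> d"
  shows "grad f x = d"
  unfolding grad_def using assms GDERIV_unique by blast

text \<open>The Riesz representer of the derivative supplies the existence that the definite
  description in \<open>grad\<close> requires.\<close>

lemma differentiable_GDERIV_grad:
  fixes f :: "'a::{real_inner, complete_space} \<Rightarrow> real"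
  assumes "f differentiable (at x)"
  shows "GDERIV f x :> grad f x"
proof -
  obtain l where l: "(f has_derivative l) (at x)"
    using assms unfolding differentiable_def by blast
  obtain d where "\<And>v. l v = inner v d"
    using riesz_representation[OF has_derivative_bounded_linear[OF l]] by blast
  hence "GDERIV f x :> d"
    using l unfolding gderiv_def by (metis ext)
  thus ?thesis using GDERIV_imp_grad by metis
qed

lemma L_smooth_GDERIV:
  fixes f :: "'a::{real_inner, complete_space} \<Rightarrow> real"
  assumes "L_smooth L f"
  shows "GDERIV f x :> grad f x"
  using assms differentiable_GDERIV_grad unfolding L_smooth_def by blast

lemma GDERIV_along_line:
  fixes f :: "'a::real_inner \<Rightarrow> real"
  assumes "GDERIV f (x + t *\<^sub>R v) :> d"
  shows "((\<lambda>t. f (x + t *\<^sub>R v)) has_real_derivative inner v d) (at t)"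
proof -
  have "((\<lambda>t. x + t *\<^sub>R v) has_derivative (\<lambda>s. s *\<^sub>R v)) (at t)"
    by (auto intro!: derivative_eq_intros)
  from has_derivative_compose[OF this assms[unfolded gderiv_def]]
  show ?thesis
    by (rule has_derivative_imp_has_field_derivative) simp
qed

text \<open>Restriction to the line through \<open>x\<close> and \<open>y\<close> reduces this to
  the tangent inequality for convex functions of one real variable.\<close>

lemma convex_on_above_tangent:
  fixes f :: "'a::real_inner \<Rightarrow> real"
  assumes conv: "convex_on UNIV f" and d: "GDERIV f x :> d"
  shows "f x + inner d (y - x) \<le> f y"
proof -
  define g where "g t = f (x + t *\<^sub>R (y - x))" for t
  have "convex_on UNIV g"
  proof (rule convex_onI)
    fix t a b :: real assume t: "0 < t" "t < 1"
    have "x + ((1 - t) *\<^sub>R a + t *\<^sub>R b) *\<^sub>R (y - x)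
        = (1 - t) *\<^sub>R (x + a *\<^sub>R (y - x)) + t *\<^sub>R (x + b *\<^sub>R (y - x))"
      by (simp add: algebra_simps)
    thus "g ((1 - t) *\<^sub>R a + t *\<^sub>R b) \<le> (1 - t) * g a + t * g b"
      using convex_onD[OF conv, of t "x + a *\<^sub>R (y - x)" "x + b *\<^sub>R (y - x)"] t
      by (simp add: g_def)
  qed simp
  moreover have "(g has_real_derivative inner (y - x) d) (at 0)"
    unfolding g_def by (rule GDERIV_along_line) (use d in simp)
  ultimately have "g 1 - g 0 \<ge> inner (y - x) d * (1 - 0)"
    by (intro convex_on_imp_above_tangent[of UNIV]) auto
  thus ?thesis by (simp add: g_def inner_commute)
qed

lemma L_smooth_descent:
  fixes f :: "'a::{real_inner, complete_space} \<Rightarrow> real"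
  assumes "L_smooth L f"
  shows "f y \<le> f x + inner (grad f x) (y - x) + L / 2 * (norm (y - x))\<^sup>2"
proof -
  define v where "v = y - x"
  \<comment> \<open>Difference between \<open>f\<close> along the segment and the non-constant part
    of its quadratic majorant. The Lipschitz bound makes its derivative nonpositive on
    \<open>[0, 1]\<close>, and \<open>g 1 \<le> g 0\<close> is the claim.\<close>
  define g where "g t = f (x + t *\<^sub>R v) - t * inner v (grad f x) - L / 2 * t\<^sup>2 * (norm v)\<^sup>2" for t
  have "g 0 \<ge> g 1"
  proof (rule DERIV_nonpos_imp_nonincreasing[of 0 1 g])
    fix t :: real assume t: "0 \<le> t" "t \<le> 1"
    let ?d = "inner v (grad f (x + t *\<^sub>R v)) - inner v (grad f x) - L * t * (norm v)\<^sup>2"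
    have "(g has_real_derivative ?d) (at t)"
      unfolding g_def
      by (rule derivative_eq_intros GDERIV_along_line L_smooth_GDERIV[OF assms] refl | simp)+
    moreover have "?d \<le> 0"
    proof -
      have "inner v (grad f (x + t *\<^sub>R v) - grad f x) \<le> norm v * norm (grad f (x + t *\<^sub>R v) - grad f x)"
        by (rule norm_cauchy_schwarz)
      also have "\<dots> \<le> norm v * (L * norm (t *\<^sub>R v))"
        using assms unfolding L_smooth_def
        by (intro mult_left_mono) (metis add_diff_cancel_left', simp)
      finally show ?thesis
        using t by (simp add: inner_diff_right power2_eq_square algebra_simps)
    qed
    ultimately show "\<exists>y. DERIV g t :> y \<and> y \<le> 0" by blast
  qed simp
  thus ?thesis by (simp add: g_def v_def inner_commute)
qed

text \<open>A gradient step of length \<open>1 / L\<close> lowers \<open>f\<close> by at least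
  \<open>(norm (grad f x))\<^sup>2 / (2 * L)\<close>, yet cannot fall below
  \<open>m\<close>.\<close>

lemma L_smooth_lower_bound_decrease:
  fixes f :: "'a::{real_inner, complete_space} \<Rightarrow> real"
  assumes "L_smooth L f" "L > 0" "\<And>y. m \<le> f y"
  shows "(norm (grad f x))\<^sup>2 \<le> 2 * L * (f x - m)"
proof -
  have "m \<le> f (x - (1 / L) *\<^sub>R grad f x)" by fact
  also have "\<dots> \<le> f x + inner (grad f x) ((x - (1 / L) *\<^sub>R grad f x) - x)
      + L / 2 * (norm ((x - (1 / L) *\<^sub>R grad f x) - x))\<^sup>2"
    by (rule L_smooth_descent) fact
  also have "\<dots> = f x - (norm (grad f x))\<^sup>2 / (2 * L)"
    using \<open>L > 0\<close> by (simp add: power2_norm_eq_inner[symmetric] power_mult_distrib field_simps)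
      (simp add: power2_eq_square)
  finally show ?thesis using \<open>L > 0\<close> by (simp add: field_simps)
qed

lemma L_smooth_argmin_grad:
  fixes f :: "'a::{real_inner, complete_space} \<Rightarrow> real"
  assumes "L_smooth L f" "L > 0" "z \<in> argmin f"
  shows "grad f z = 0"
  using L_smooth_lower_bound_decrease[OF assms(1,2), of "f z" z] assms(3)
  by (auto simp: argmin_def)

text \<open>The gradient step from \<open>x\<close> on the convex function \<open>u \<mapsto> f u - \<langle>\<nabla>f y, u\<rangle>\<close>,
  which is minimal at \<open>y\<close>.\<close>

lemma L_smooth_convex_cocoercive:
  fixes f :: "'a::{real_inner, complete_space} \<Rightarrow> real"
  assumes smooth: "L_smooth L f" and L: "L > 0" and conv: "convex_on UNIV f"
  shows "(norm (grad f x - grad f y))\<^sup>2 \<le> 2 * L * (f x - f y - inner (grad f y) (x - y))"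
proof -
  define d where "d = grad f x - grad f y"
  define z where "z = x - (1 / L) *\<^sub>R d"
  have "f y + inner (grad f y) (z - y) \<le> f z"
    by (rule convex_on_above_tangent[OF conv L_smooth_GDERIV[OF smooth]])
  also have "f z \<le> f x + inner (grad f x) (z - x) + L / 2 * (norm (z - x))\<^sup>2"
    by (rule L_smooth_descent) fact
  also have "(norm (z - x))\<^sup>2 = (norm d)\<^sup>2 / L\<^sup>2"
    unfolding z_def using L by (simp add: power_divide)
  finally have 1: "f y + inner (grad f y) (z - y) \<le> f x + inner (grad f x) (z - x) + (norm d)\<^sup>2 / (2 * L)"
    using L by (simp add: power2_eq_square)
  have 2: "inner (grad f y) (z - y) = inner (grad f y) (x - y) - inner (grad f y) d / L"
    by (simp add: z_def inner_diff_right)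
  have 3: "inner (grad f x) (z - x) = - inner (grad f x) d / L"
    by (simp add: z_def inner_diff_right)
  have 4: "inner (grad f x) d / L - inner (grad f y) d / L = (norm d)\<^sup>2 / L"
    by (simp add: diff_divide_distrib[symmetric] inner_diff_left[symmetric] power2_norm_eq_inner)
      (simp add: d_def)
  have "(norm d)\<^sup>2 / L - (norm d)\<^sup>2 / (2 * L) = (norm d)\<^sup>2 / (2 * L)"
    using L by (simp add: field_simps)
  with 1 2 3 4 have "(norm d)\<^sup>2 / (2 * L) \<le> f x - f y - inner (grad f y) (x - y)"
    by (simp add: minus_divide_left[symmetric])
  thus ?thesis using L by (simp add: d_def field_simps)
qed

section \<open>Quadratic growth\<close>

text \<open>Carries bounds valid for every \<open>z\<close> over to the infimum, which need not be
  attained. A negative \<open>c\<close> is covered too, and such values can occur in the later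
  uses.\<close>

lemma le_infdist_power2:
  fixes x :: "'a::metric_space"
  assumes "A \<noteq> {}" "\<And>z. z \<in> A \<Longrightarrow> c \<le> (dist x z)\<^sup>2"
  shows "c \<le> (infdist x A)\<^sup>2"
proof -
  have "sqrt c \<le> infdist x A"
    unfolding infdist_notempty[OF assms(1)]
    by (rule cINF_greatest) (use assms in \<open>auto intro: real_le_lsqrt real_sqrt_le_iff\<close>)
  thus ?thesis
    by (simp add: sqrt_le_D)
qed

text \<open>Along gradient descent \<open>s = sqrt (F - m)\<close> drops by at least
  \<open>r * c\<close> times the distance travelled. The path thus has length at most
  \<open>s x / (r * c)\<close> and ends at a point of value \<open>m\<close>; finally
  \<open>r\<close> tends to 1.\<close>

lemma quadratic_growth:
  fixes F :: "'a::{real_inner, complete_space} \<Rightarrow> real"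
  assumes smooth: "L_smooth L F" and L: "L > 0" and \<mu>: "\<mu> > 0"
    and lower: "\<And>y. m \<le> F y"
    and PL: "\<And>x. F x - m \<le> 1 / (2 * \<mu>) * (norm (grad F x))\<^sup>2"
  shows "\<mu> / 2 * (infdist x {z. F z = m})\<^sup>2 \<le> F x - m"
proof -
  define c where "c = sqrt (\<mu> / 2)"
  have c: "c > 0" "c\<^sup>2 = \<mu> / 2" using \<mu> by (auto simp: c_def)
  define s where "s x = sqrt (F x - m)" for x
  have s2: "(s x)\<^sup>2 = F x - m" and s0: "s x \<ge> 0" for x
    using lower[of x] by (auto simp: s_def)
  have PL': "2 * c * s x \<le> norm (grad F x)" for x
  proof (rule power2_le_imp_le)
    show "(2 * c * s x)\<^sup>2 \<le> (norm (grad F x))\<^sup>2"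
      using PL[of x] \<mu> by (simp add: power_mult_distrib c s2 field_simps)
  qed simp
  have "r * (c * infdist x {z. F z = m}) \<le> s x" if r: "0 < r" "r < 1" for r
  proof -
    \<comment> \<open>Chosen so that \<open>1 - L * h / 2 = r\<close>: the descent inequality then
      retains exactly the fraction \<open>r\<close> of the first-order decrease.\<close>
    define h where "h = 2 * (1 - r) / L"
    have h: "h > 0" using r L by (simp add: h_def)
    define T where "T y = y - h *\<^sub>R grad F y" for y
    have dec: "F (T y) \<le> F y - r * h * (norm (grad F y))\<^sup>2" for y
    proof -
      have "F (T y) \<le> F y + inner (grad F y) (T y - y) + L / 2 * (norm (T y - y))\<^sup>2"
        by (rule L_smooth_descent) fact
      also have "inner (grad F y) (T y - y) = - h * (norm (grad F y))\<^sup>2"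
        by (simp add: T_def power2_norm_eq_inner)
      also have "(norm (T y - y))\<^sup>2 = h * h * (norm (grad F y))\<^sup>2"
        by (simp add: T_def power_mult_distrib power2_eq_square)
      also have "L / 2 * (h * h * (norm (grad F y))\<^sup>2) = (L * h / 2) * h * (norm (grad F y))\<^sup>2"
        by simp
      also have "L * h / 2 = 1 - r"
        using L by (simp add: h_def)
      finally show ?thesis by (simp add: algebra_simps)
    qed
    have step: "s (T y) + r * c * dist y (T y) \<le> s y" for y
    proof -
      define g where "g = norm (grad F y)"
      define a where "a = r * h"
      have a: "a > 0" using r h by (simp add: a_def)
      have g0: "g \<ge> 0" by (simp add: g_def)
      have D: "(s (T y))\<^sup>2 \<le> (s y)\<^sup>2 - a * g\<^sup>2"
        using dec[of y] by (simp add: s2 a_def g_def)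
      have pl: "2 * c * s y \<le> g" using PL' by (simp add: g_def)
      \<comment> \<open>The Polyak--Lojasiewicz bound multiplied by \<open>a * g\<close>: the
        decrease \<open>a * g\<^sup>2\<close> covers the cross term of
        \<open>(s y - a * c * g)\<^sup>2\<close>.\<close>
      have prod: "2 * (a * c * g) * s y \<le> a * g\<^sup>2"
        using mult_left_mono[OF pl, of "a * g"] a g0 by (simp add: power2_eq_square algebra_simps)
      have "s (T y) \<le> s y - a * c * g"
      proof (rule power2_le_imp_le)
        have "(s y - a * c * g)\<^sup>2 = (s y)\<^sup>2 - 2 * (a * c * g) * s y + (a * c * g)\<^sup>2"
          by (simp add: power2_diff)
        thus "(s (T y))\<^sup>2 \<le> (s y - a * c * g)\<^sup>2"
          using D prod zero_le_power2[of "a * c * g"] by linarith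
        have le: "a * g\<^sup>2 \<le> (s y)\<^sup>2" using D by (smt (verit) zero_le_power2)
        \<comment> \<open>Comparing squares needs this sign. If \<open>s y\<close> vanishes then so
          does the gradient; otherwise dividing by \<open>s y\<close> gives even
          \<open>2 * (a * c * g) \<le> s y\<close>.\<close>
        show "0 \<le> s y - a * c * g"
        proof (cases "s y = 0")
          case True
          hence "a * g\<^sup>2 \<le> 0" using le by simp
          hence "g = 0" using a by (simp add: mult_le_0_iff)
          thus ?thesis using s0 by simp
        next
          case False
          hence pos: "s y > 0" using s0[of y] by simp
          have "2 * (a * c * g) * s y \<le> s y * s y"
            using prod le by (simp add: power2_eq_square)
          hence "2 * (a * c * g) \<le> s y" using pos by simp
          thus ?thesis using pos by linarith
        qed
      qed
      moreover have "r * c * dist y (T y) = a * c * g"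
        using h by (simp add: T_def dist_norm a_def g_def)
      ultimately show ?thesis by linarith
    qed
    define X where "X k = (T ^^ k) x" for k
    have X0: "X 0 = x" and XS: "X (Suc k) = T (X k)" for k by (simp_all add: X_def)
    have path: "s (X j) + r * c * dist (X i) (X j) \<le> s (X i)" if "i \<le> j" for i j
      using that
    proof (induction rule: dec_induct)
      case (step j)
      have "dist (X i) (X (Suc j)) \<le> dist (X i) (X j) + dist (X j) (X (Suc j))"
        by (rule dist_triangle)
      hence "r * c * dist (X i) (X (Suc j)) \<le> r * c * dist (X i) (X j) + r * c * dist (X j) (X (Suc j))"
        using r c by (simp add: distrib_left[symmetric])
      with step.IH \<open>\<And>y. s (T y) + r * c * dist y (T y) \<le> s y\<close>[of "X j"] show ?case
        by (simp add: XS)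
    qed simp
    \<comment> \<open>The maximum with 0 keeps the ratio nonnegative, as needed for iterating the
      inequality and for the convergence of its powers.\<close>
    define \<rho> where "\<rho> = max 0 (1 - 2 * \<mu> * (r * h))"
    have \<rho>: "0 \<le> \<rho>" "\<rho> < 1" using \<mu> r h by (auto simp: \<rho>_def)
    have lin: "(s (X k))\<^sup>2 \<le> \<rho> ^ k * (s x)\<^sup>2" for k
    proof (induction k)
      case (Suc k)
      have "(s (X (Suc k)))\<^sup>2 \<le> (s (X k))\<^sup>2 - r * h * (norm (grad F (X k)))\<^sup>2"
        using dec[of "X k"] by (simp add: s2 XS)
      also have "\<dots> \<le> (s (X k))\<^sup>2 - r * h * (2 * \<mu> * (s (X k))\<^sup>2)"
        using PL[of "X k"] r h \<mu> by (intro diff_left_mono mult_left_mono) (auto simp: s2 field_simps)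
      also have "\<dots> = (1 - 2 * \<mu> * (r * h)) * (s (X k))\<^sup>2" by (simp add: algebra_simps)
      also have "\<dots> \<le> \<rho> * (s (X k))\<^sup>2"
        by (intro mult_right_mono) (auto simp: \<rho>_def)
      also have "\<dots> \<le> \<rho> * (\<rho> ^ k * (s x)\<^sup>2)"
        using Suc \<rho> by (intro mult_left_mono)
      finally show ?case by (simp add: mult.assoc)
    qed (simp add: X0)
    have "(\<lambda>k. \<rho> ^ k * (s x)\<^sup>2) \<longlonglongrightarrow> 0"
      using tendsto_mult_right[OF LIMSEQ_realpow_zero[OF \<rho>], of "(s x)\<^sup>2"] by simp
    moreover have "\<forall>\<^sub>F k in sequentially. norm ((s (X k))\<^sup>2) \<le> \<rho> ^ k * (s x)\<^sup>2"
      using lin by simp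
    ultimately have lim2: "(\<lambda>k. (s (X k))\<^sup>2) \<longlonglongrightarrow> 0"
      by (rule Lim_null_comparison[rotated])
    hence lims: "(\<lambda>k. s (X k)) \<longlonglongrightarrow> 0"
      using tendsto_real_sqrt[OF lim2] s0 by simp
    \<comment> \<open>The distance from \<open>X N\<close> to any later iterate is at most
      \<open>s (X N) / (r * c)\<close>, which tends to 0.\<close>
    have "Cauchy X"
    proof (rule metric_CauchyI)
      fix e :: real assume e: "e > 0"
      have "\<forall>\<^sub>F k in sequentially. s (X k) < r * c * e / 2"
        using lims r c e by (intro order_tendstoD) auto
      then obtain N where N: "s (X N) < r * c * e / 2"
        by (auto simp: eventually_sequentially)
      have near: "dist (X N) (X k) < e / 2" if "k \<ge> N" for k
      proof -
        have "r * c * dist (X N) (X k) < r * c * (e / 2)"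
          using path[OF that] s0[of "X k"] N by simp
        thus ?thesis using r c by simp
      qed
      have "dist (X i) (X j) < e" if "i \<ge> N" "j \<ge> N" for i j
        using near[OF that(1)] near[OF that(2)] dist_triangle3[of "X i" "X j" "X N"] by linarith
      thus "\<exists>N. \<forall>i\<ge>N. \<forall>j\<ge>N. dist (X i) (X j) < e" by blast
    qed
    then obtain z where z: "X \<longlonglongrightarrow> z" using convergent_eq_Cauchy by blast
    have "isCont F z"
      using smooth unfolding L_smooth_def
      by (simp add: differentiable_imp_continuous_within)
    hence "(\<lambda>k. F (X k)) \<longlonglongrightarrow> F z" using z isCont_tendsto_compose by blast
    hence "(\<lambda>k. (s (X k))\<^sup>2) \<longlonglongrightarrow> F z - m" unfolding s2 by (intro tendsto_intros)
    hence "F z = m" using LIMSEQ_unique[OF lim2] by fastforce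
    have "(\<lambda>k. s (X k) + r * c * dist x (X k)) \<longlonglongrightarrow> 0 + r * c * dist x z"
      by (intro tendsto_intros lims z)
    hence "0 + r * c * dist x z \<le> s x"
      by (rule LIMSEQ_le_const2) (use path[of 0] X0 in auto)
    moreover have "r * c * infdist x {z. F z = m} \<le> r * c * dist x z"
      using r c \<open>F z = m\<close> by (intro mult_left_mono infdist_le) auto
    ultimately show ?thesis by (simp add: mult.assoc)
  qed
  hence "c * infdist x {z. F z = m} \<le> s x" by (rule field_le_mult_one_interval)
  hence "(c * infdist x {z. F z = m})\<^sup>2 \<le> (s x)\<^sup>2"
    using c by (intro power_mono) (auto simp: infdist_nonneg)
  thus ?thesis by (simp add: power_mult_distrib c s2)
qed

section \<open>Proximal steps\<close>

text \<open>The fixed point \<open>u\<close> of the contraction \<open>?T\<close> is a stationary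
  point of the strongly convex objective \<open>H\<close>. The quadratic lower bound at
  \<open>u\<close> yields both uniqueness of the minimizer and the inequality.\<close>

lemma prox_three_point:
  fixes f :: "'a::{real_inner, complete_space} \<Rightarrow> real"
  assumes smooth: "L_smooth L f" and conv: "convex_on UNIV f"
    and \<alpha>: "\<alpha> > 0" "L \<ge> 0" "\<alpha> * L < 1"
  defines "p \<equiv> \<lambda>z. prox (\<lambda>y. \<alpha> * f y) z"
  shows "(norm (p z - y))\<^sup>2 \<le> (norm (z - y))\<^sup>2 - (norm (p z - z))\<^sup>2 - 2 * \<alpha> * (f (p z) - f y)"
proof -
  let ?T = "\<lambda>u. z - \<alpha> *\<^sub>R grad f u"
  have "\<exists>!u. ?T u = u"
  proof (rule banach_fix_type[of "\<alpha> * L"])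
    show "\<forall>u v. dist (?T u) (?T v) \<le> \<alpha> * L * dist u v"
    proof (intro allI)
      fix u v
      have "dist (?T u) (?T v) = \<alpha> * norm (grad f u - grad f v)"
      proof -
        have "?T u - ?T v = \<alpha> *\<^sub>R (grad f v - grad f u)" by (simp add: algebra_simps)
        thus ?thesis using \<alpha> by (simp add: dist_norm norm_minus_commute)
      qed
      also have "\<dots> \<le> \<alpha> * (L * norm (u - v))"
        using smooth \<alpha> unfolding L_smooth_def by (intro mult_left_mono) auto
      finally show "dist (?T u) (?T v) \<le> \<alpha> * L * dist u v" by (simp add: dist_norm)
    qed
  qed (use \<alpha> in auto)
  then obtain u where u: "z - \<alpha> *\<^sub>R grad f u = u" by blast
  define H where "H y = \<alpha> * f y + 1 / 2 * (norm (y - z))\<^sup>2" for y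
  \<comment> \<open>Tangent inequality for \<open>f\<close> at \<open>u\<close> plus the exact
    expansion of the square; the linear terms cancel because
    \<open>\<alpha> *\<^sub>R grad f u = z - u\<close>.\<close>
  have strong: "H u + 1 / 2 * (norm (y - u))\<^sup>2 \<le> H y" for y
  proof -
    have "\<alpha> * (f u + inner (grad f u) (y - u)) \<le> \<alpha> * f y"
      using \<alpha> convex_on_above_tangent[OF conv L_smooth_GDERIV[OF smooth]] by simp
    moreover have "\<alpha> * inner (grad f u) (y - u) = inner (z - u) (y - u)"
      using u by (metis add_diff_cancel_left' diff_add_cancel inner_scaleR_left)
    moreover have "(norm (y - z))\<^sup>2 = (norm (u - z))\<^sup>2 + (norm (y - u))\<^sup>2 - 2 * inner (z - u) (y - u)"
      by (simp add: power2_norm_eq_inner algebra_simps inner_commute)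
    ultimately show ?thesis
      by (simp add: H_def distrib_left add_divide_distrib diff_divide_distrib)
  qed
  \<comment> \<open>Only for a singleton does \<open>the_elem\<close> in \<open>prox\<close> return
    the minimizer.\<close>
  have "argmin H = {u}"
  proof (intro equalityI subsetI)
    fix w assume "w \<in> argmin H"
    hence "H w \<le> H u" by (simp add: argmin_def)
    with strong[of w] have "(norm (w - u))\<^sup>2 \<le> 0" by linarith
    thus "w \<in> {u}" by simp
  next
    fix w assume "w \<in> {u}"
    have "H u \<le> H y" for y using strong[of y] zero_le_power2[of "norm (y - u)"] by linarith
    thus "w \<in> argmin H" using \<open>w \<in> {u}\<close> by (simp add: argmin_def)
  qed
  hence "p z = u" unfolding p_def prox_def H_def by simp
  thus ?thesis
    using strong[of y] unfolding H_def
    by (simp add: norm_minus_commute[of y] algebra_simps)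
qed

text \<open>The value at the proximal point is replaced by the value at \<open>x\<close>, on which
  the average over the drawn index can act. Convexity gives a linear term in \<open>u - x\<close>;
  completing the square removes \<open>u\<close> and leaves the noise
  \<open>\<alpha>\<^sup>2 * (norm (grad f x - e))\<^sup>2\<close>.\<close>

lemma prox_step:
  fixes f :: "'a::{real_inner, complete_space} \<Rightarrow> real"
  assumes smooth: "L_smooth L f" and conv: "convex_on UNIV f"
    and \<alpha>: "\<alpha> > 0" "L \<ge> 0" "\<alpha> * L < 1"
  defines "p \<equiv> \<lambda>z. prox (\<lambda>y. \<alpha> * f y) z"
  shows "(norm (p (x + \<alpha> *\<^sub>R e) - y))\<^sup>2 \<le> (norm (x - y))\<^sup>2 + 2 * \<alpha> * inner e (x - y)
    + \<alpha>\<^sup>2 * (norm (grad f x - e))\<^sup>2 - 2 * \<alpha> * (f x - f y)"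
proof -
  define u where "u = p (x + \<alpha> *\<^sub>R e)"
  have "(norm (u - y))\<^sup>2 \<le> (norm (x + \<alpha> *\<^sub>R e - y))\<^sup>2 - (norm (u - (x + \<alpha> *\<^sub>R e)))\<^sup>2
      - 2 * \<alpha> * (f u - f y)"
    unfolding u_def p_def by (rule prox_three_point[OF smooth conv \<alpha>])
  moreover have "(norm (x + \<alpha> *\<^sub>R e - y))\<^sup>2 = (norm (x - y))\<^sup>2 + 2 * \<alpha> * inner e (x - y) + \<alpha>\<^sup>2 * (norm e)\<^sup>2"
    unfolding power2_norm_eq_inner
    by (simp add: algebra_simps inner_commute power2_eq_square)
  moreover have "(norm (u - (x + \<alpha> *\<^sub>R e)))\<^sup>2
      = (norm (u - x))\<^sup>2 - 2 * \<alpha> * inner e (u - x) + \<alpha>\<^sup>2 * (norm e)\<^sup>2"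
    unfolding power2_norm_eq_inner
    by (simp add: algebra_simps inner_commute power2_eq_square)
  moreover have "2 * \<alpha> * (f x + inner (grad f x) (u - x)) \<le> 2 * \<alpha> * f u"
    using \<alpha> convex_on_above_tangent[OF conv L_smooth_GDERIV[OF smooth]] by simp
  moreover have "(norm (u - x + \<alpha> *\<^sub>R (grad f x - e)))\<^sup>2 = (norm (u - x))\<^sup>2
      + 2 * \<alpha> * inner (grad f x) (u - x) - 2 * \<alpha> * inner e (u - x) + \<alpha>\<^sup>2 * (norm (grad f x - e))\<^sup>2"
    unfolding power2_norm_eq_inner
    by (simp add: algebra_simps inner_commute power2_eq_square)
  moreover have "0 \<le> (norm (u - x + \<alpha> *\<^sub>R (grad f x - e)))\<^sup>2" by simp
  ultimately show ?thesis
    unfolding u_def[symmetric] right_diff_distrib distrib_left by linarith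
qed

text \<open>A variance is at most the second moment; the difference is \<open>card I\<close> times
  the squared norm of the mean.\<close>

lemma sum_norm_centered_le:
  fixes a :: "'i \<Rightarrow> 'a::real_inner"
  assumes "finite I"
  shows "(\<Sum>i\<in>I. (norm (a i - (1 / real (card I)) *\<^sub>R (\<Sum>j\<in>I. a j)))\<^sup>2) \<le> (\<Sum>i\<in>I. (norm (a i))\<^sup>2)"
proof (cases "I = {}")
  case False
  define c where "c = (1 / real (card I)) *\<^sub>R (\<Sum>j\<in>I. a j)"
  have c: "(\<Sum>j\<in>I. a j) = real (card I) *\<^sub>R c" using False assms by (simp add: c_def)
  have "(\<Sum>i\<in>I. (norm (a i - c))\<^sup>2) = (\<Sum>i\<in>I. (norm (a i))\<^sup>2 - 2 * inner (a i) c + (norm c)\<^sup>2)"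
    by (intro sum.cong) (auto simp: power2_norm_eq_inner algebra_simps inner_commute)
  also have "\<dots> = (\<Sum>i\<in>I. (norm (a i))\<^sup>2) - 2 * inner (\<Sum>i\<in>I. a i) c + real (card I) * (norm c)\<^sup>2"
    by (simp add: sum.distrib sum_subtractf sum_distrib_left inner_sum_left)
  also have "\<dots> = (\<Sum>i\<in>I. (norm (a i))\<^sup>2) - real (card I) * (norm c)\<^sup>2"
    unfolding c by (simp add: power2_norm_eq_inner)
  finally show ?thesis unfolding c_def by simp
qed simp

lemma norm_diff_square_le:
  fixes u v :: "'a::real_inner"
  shows "(norm (u - v))\<^sup>2 \<le> 2 * (norm u)\<^sup>2 + 2 * (norm v)\<^sup>2"
proof -
  have "(norm (u - v))\<^sup>2 + (norm (u + v))\<^sup>2 = 2 * (norm u)\<^sup>2 + 2 * (norm v)\<^sup>2"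
    by (simp add: power2_norm_eq_inner algebra_simps inner_commute)
  thus ?thesis by (smt (verit) zero_le_power2)
qed

section \<open>Finite sums of smooth convex functions and the expected effect of one draw\<close>

locale finite_sum_problem =
  fixes n :: nat
    and f :: "nat \<Rightarrow> 'a::{real_inner, complete_space} \<Rightarrow> real"
    and F :: "'a \<Rightarrow> real"
    and L :: real
  assumes n: "n \<ge> 1"
    and F: "F = (\<lambda>y. 1 / real n * (\<Sum>i=1..n. f i y))"
    and argmin: "argmin F \<noteq> {}"
    and L: "L > 0"
    and convex: "\<And>i. i \<in> {1..n} \<Longrightarrow> convex_on UNIV (f i)"
    and smooth: "\<And>i. i \<in> {1..n} \<Longrightarrow> L_smooth L (f i)"
begin

lemma GDERIV_F: "GDERIV F x :> (1 / real n) *\<^sub>R (\<Sum>i=1..n. grad (f i) x)"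
proof -
  have "(F has_derivative (\<lambda>h. 1 / real n * (\<Sum>i=1..n. inner h (grad (f i) x)))) (at x)"
    unfolding F using L_smooth_GDERIV[OF smooth, unfolded gderiv_def]
    by (intro has_derivative_mult_right has_derivative_sum) auto
  thus ?thesis by (simp add: gderiv_def inner_sum_right)
qed

lemma grad_F: "grad F x = (1 / real n) *\<^sub>R (\<Sum>i=1..n. grad (f i) x)"
  by (rule GDERIV_imp_grad[OF GDERIV_F])

lemma F_smooth: "L_smooth L F"
  unfolding L_smooth_def
proof (intro conjI allI)
  show "F differentiable (at x)" for x
    using GDERIV_F unfolding gderiv_def differentiable_def by blast
  show "norm (grad F x - grad F y) \<le> L * norm (x - y)" for x y
  proof -
    have "norm (\<Sum>i=1..n. grad (f i) x - grad (f i) y) \<le> (\<Sum>i=1..n. L * norm (x - y))"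
      by (rule sum_norm_le) (use smooth in \<open>auto simp: L_smooth_def\<close>)
    moreover have "grad F x - grad F y = (1 / real n) *\<^sub>R (\<Sum>i=1..n. grad (f i) x - grad (f i) y)"
      by (simp add: grad_F sum_subtractf scaleR_diff_right)
    ultimately show ?thesis using n by (simp add: field_simps)
  qed
qed

lemma sum_grad_argmin: "z \<in> argmin F \<Longrightarrow> (\<Sum>i=1..n. grad (f i) z) = 0"
  using L_smooth_argmin_grad[OF F_smooth L, of z] n by (simp add: grad_F)

lemma sum_f: "(\<Sum>i=1..n. f i x) = real n * F x"
  using n by (simp add: F)

text \<open>Cocoercivity summed over \<open>i\<close>; the linear terms cancel because the gradients
  at a minimizer sum to 0.\<close>

lemma sum_norm_grad_diff_le:
  assumes z: "z \<in> argmin F"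
  shows "(\<Sum>i=1..n. (norm (grad (f i) x - grad (f i) z))\<^sup>2) \<le> 2 * L * real n * (F x - F z)"
proof -
  have "(\<Sum>i=1..n. (norm (grad (f i) x - grad (f i) z))\<^sup>2)
      \<le> (\<Sum>i=1..n. 2 * L * (f i x - f i z - inner (grad (f i) z) (x - z)))"
    by (intro sum_mono L_smooth_convex_cocoercive smooth convex L)
  also have "\<dots> = 2 * L * ((\<Sum>i=1..n. f i x) - (\<Sum>i=1..n. f i z) - inner (\<Sum>i=1..n. grad (f i) z) (x - z))"
    by (simp only: sum_distrib_left[symmetric] sum_subtractf inner_sum_left)
  finally show ?thesis
    unfolding sum_f sum_grad_argmin[OF z] by (simp add: algebra_simps)
qed

text \<open>Between two minimizers the optimality gap is 0, so each squared gradient difference in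
  the preceding bound vanishes.\<close>

lemma grad_eq_on_argmin:
  assumes z: "z \<in> argmin F" and w: "w \<in> argmin F" and i: "i \<in> {1..n}"
  shows "grad (f i) z = grad (f i) w"
proof -
  have "F z = F w" using z w by (auto simp: argmin_def intro: antisym)
  hence "(\<Sum>i=1..n. (norm (grad (f i) z - grad (f i) w))\<^sup>2) \<le> 0"
    using sum_norm_grad_diff_le[OF w, of z] by simp
  hence "(\<Sum>i=1..n. (norm (grad (f i) z - grad (f i) w))\<^sup>2) = 0"
    by (intro antisym sum_nonneg) auto
  thus ?thesis using i by (subst (asm) sum_nonneg_eq_0_iff) auto
qed

lemma Inf_F: "z \<in> argmin F \<Longrightarrow> (INF y. F y) = F z"
  by (rule cInf_eq_minimum) (auto simp: argmin_def)

lemma argmin_eq: "z \<in> argmin F \<Longrightarrow> argmin F = {y. F y = F z}"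
  by (auto simp: argmin_def intro: antisym)

text \<open>The descent inequality at a minimizer, where the gradient is 0. It turns the bound on
  distances into the bound on values.\<close>

lemma F_gap_le: "F x - (INF y. F y) \<le> L / 2 * (infdist x (argmin F))\<^sup>2"
proof -
  have "2 / L * (F x - (INF y. F y)) \<le> (infdist x (argmin F))\<^sup>2"
  proof (rule le_infdist_power2[OF argmin])
    fix z assume z: "z \<in> argmin F"
    have "F x \<le> F z + L / 2 * (norm (x - z))\<^sup>2"
      using L_smooth_descent[OF F_smooth, of x z] L_smooth_argmin_grad[OF F_smooth L z] by simp
    thus "2 / L * (F x - (INF y. F y)) \<le> (dist x z)\<^sup>2"
      using L by (simp add: Inf_F[OF z] dist_norm field_simps)
  qed
  thus ?thesis using L by (simp add: field_simps)
qed

lemma quadratic_growth_F: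
  assumes "\<mu> > 0" "polyak_lojasiewicz \<mu> F"
  shows "\<mu> / 2 * (infdist x (argmin F))\<^sup>2 \<le> F x - (INF y. F y)"
proof -
  obtain z where z: "z \<in> argmin F" using argmin by blast
  show ?thesis
    unfolding argmin_eq[OF z] Inf_F[OF z]
    by (rule quadratic_growth[OF F_smooth L assms(1)])
      (use z assms(2) in \<open>auto simp: argmin_def polyak_lojasiewicz_def Inf_F[OF z]\<close>)
qed

text \<open>The recursion of \<open>sapa\<close> as a function of the state and the index
  \<open>i\<close>, so that it can be averaged over \<open>i\<close> with the state fixed.\<close>

definition iterate_step :: "real \<Rightarrow> 'a \<Rightarrow> (nat \<Rightarrow> 'a) \<Rightarrow> nat \<Rightarrow> 'a" where
  "iterate_step \<alpha> x \<phi> i = prox (\<lambda>y. \<alpha> * f i y)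
     (x + \<alpha> *\<^sub>R grad (f i) (\<phi> i) - (\<alpha> / real n) *\<^sub>R (\<Sum>j=1..n. grad (f j) (\<phi> j)))"

definition memory_step :: "'a \<Rightarrow> (nat \<Rightarrow> 'a) \<Rightarrow> nat \<Rightarrow> nat \<Rightarrow> 'a" where
  "memory_step x \<phi> i j = \<phi> j + (if j = i then 1 else 0) *\<^sub>R (x - \<phi> j)"

definition grad_variance :: "'a \<Rightarrow> (nat \<Rightarrow> 'a) \<Rightarrow> real" where
  "grad_variance xs \<phi> = 1 / real n * (\<Sum>i=1..n. (norm (grad (f i) (\<phi> i) - grad (f i) xs))\<^sup>2)"

definition lyapunov :: "real \<Rightarrow> real \<Rightarrow> 'a \<Rightarrow> 'a \<Rightarrow> (nat \<Rightarrow> 'a) \<Rightarrow> real" where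
  "lyapunov \<alpha> M xs x \<phi> = (infdist x (argmin F))\<^sup>2 + \<alpha>\<^sup>2 * M * grad_variance xs \<phi>"

lemma grad_variance_nonneg: "0 \<le> grad_variance xs \<phi>"
  by (simp add: grad_variance_def sum_nonneg)

lemma grad_variance_argmin:
  "xs \<in> argmin F \<Longrightarrow> z \<in> argmin F \<Longrightarrow> grad_variance xs \<phi> = grad_variance z \<phi>"
  unfolding grad_variance_def using grad_eq_on_argmin[of xs z] by simp

text \<open>The corrections \<open>e i\<close> sum to 0, so their inner products with
  \<open>x - z\<close> disappear. The noise splits into a part bounded by the gap, responsible for
  the factor \<open>1 - 2 * \<alpha> * L\<close>, and the variance of the stored gradients.\<close>

lemma sum_norm_iterate_step_le:
  assumes \<alpha>: "\<alpha> > 0" "\<alpha> * L < 1" and z: "z \<in> argmin F"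
  shows "(\<Sum>i=1..n. (norm (iterate_step \<alpha> x \<phi> i - z))\<^sup>2)
    \<le> real n * ((norm (x - z))\<^sup>2 - 2 * \<alpha> * (1 - 2 * \<alpha> * L) * (F x - F z) + 2 * \<alpha>\<^sup>2 * grad_variance z \<phi>)"
proof -
  define c where "c = (1 / real n) *\<^sub>R (\<Sum>j=1..n. grad (f j) (\<phi> j))"
  define e where "e i = grad (f i) (\<phi> i) - c" for i
  define a where "a i = grad (f i) (\<phi> i) - grad (f i) z" for i
  have sum_e: "(\<Sum>i=1..n. e i) = 0"
    using n by (simp add: e_def c_def sum_subtractf sum_constant_scaleR)
  \<comment> \<open>Subtracting the gradients at \<open>z\<close> leaves the mean unchanged, since
    they sum to 0. Hence \<open>a i - c\<close> is centered.\<close>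
  have c_a: "c = (1 / real (card {1..n})) *\<^sub>R (\<Sum>j=1..n. a j)"
    by (simp add: c_def a_def sum_subtractf sum_grad_argmin[OF z] del: One_nat_def)
  have step: "iterate_step \<alpha> x \<phi> i = prox (\<lambda>y. \<alpha> * f i y) (x + \<alpha> *\<^sub>R e i)" for i
    by (simp add: iterate_step_def e_def c_def scaleR_diff_right add_diff_eq)
  have var: "(\<Sum>i=1..n. (norm (a i - c))\<^sup>2) \<le> real n * grad_variance z \<phi>"
    using sum_norm_centered_le[of "{1..n}" a] n unfolding c_a[symmetric]
    by (simp add: grad_variance_def a_def)
  have "(norm (grad (f i) x - e i))\<^sup>2
      \<le> 2 * (norm (grad (f i) x - grad (f i) z))\<^sup>2 + 2 * (norm (a i - c))\<^sup>2" for i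
    using norm_diff_square_le[of "grad (f i) x - grad (f i) z" "a i - c"]
    by (simp add: a_def e_def algebra_simps)
  hence "(\<Sum>i=1..n. (norm (grad (f i) x - e i))\<^sup>2)
      \<le> (\<Sum>i=1..n. 2 * (norm (grad (f i) x - grad (f i) z))\<^sup>2 + 2 * (norm (a i - c))\<^sup>2)"
    by (intro sum_mono)
  also have "\<dots> = 2 * (\<Sum>i=1..n. (norm (grad (f i) x - grad (f i) z))\<^sup>2) + 2 * (\<Sum>i=1..n. (norm (a i - c))\<^sup>2)"
    by (simp add: sum.distrib sum_distrib_left)
  also have "\<dots> \<le> 2 * (2 * L * real n * (F x - F z)) + 2 * (real n * grad_variance z \<phi>)"
    using var sum_norm_grad_diff_le[OF z, of x] by linarith
  finally have noise: "(\<Sum>i=1..n. (norm (grad (f i) x - e i))\<^sup>2)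
      \<le> 2 * (2 * L * real n * (F x - F z)) + 2 * (real n * grad_variance z \<phi>)" .
  have "(\<Sum>i=1..n. (norm (iterate_step \<alpha> x \<phi> i - z))\<^sup>2)
      \<le> (\<Sum>i=1..n. (norm (x - z))\<^sup>2 + 2 * \<alpha> * inner (e i) (x - z)
          + \<alpha>\<^sup>2 * (norm (grad (f i) x - e i))\<^sup>2 - 2 * \<alpha> * (f i x - f i z))"
    unfolding step by (intro sum_mono prox_step[where L = L] smooth convex \<alpha>) (use L in auto)
  also have "\<dots> = real n * (norm (x - z))\<^sup>2 + 2 * \<alpha> * inner (\<Sum>i=1..n. e i) (x - z)
      + \<alpha>\<^sup>2 * (\<Sum>i=1..n. (norm (grad (f i) x - e i))\<^sup>2)
      - 2 * \<alpha> * ((\<Sum>i=1..n. f i x) - (\<Sum>i=1..n. f i z))"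
    by (simp only: sum.distrib sum_subtractf sum_distrib_left[symmetric] inner_sum_left) simp
  also have "\<dots> \<le> real n * (norm (x - z))\<^sup>2
      + \<alpha>\<^sup>2 * (2 * (2 * L * real n * (F x - F z)) + 2 * (real n * grad_variance z \<phi>))
      - 2 * \<alpha> * (real n * F x - real n * F z)"
    using mult_left_mono[OF noise, of "\<alpha>\<^sup>2"] unfolding sum_e sum_f by simp
  finally show ?thesis by (simp add: algebra_simps power2_eq_square)
qed

text \<open>The gradients of the \<open>f i\<close> agree on all minimizers, so the bound for \<open>norm (x - z)\<close> may be
  minimized over \<open>z\<close> without a projection onto the set of minimizers.\<close>

lemma sum_infdist_iterate_step_le:
  assumes \<alpha>: "\<alpha> > 0" "\<alpha> * L < 1" and xs: "xs \<in> argmin F"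
  shows "(\<Sum>i=1..n. (infdist (iterate_step \<alpha> x \<phi> i) (argmin F))\<^sup>2)
    \<le> real n * ((infdist x (argmin F))\<^sup>2 - 2 * \<alpha> * (1 - 2 * \<alpha> * L) * (F x - (INF y. F y))
        + 2 * \<alpha>\<^sup>2 * grad_variance xs \<phi>)"
proof -
  let ?S = "\<Sum>i=1..n. (infdist (iterate_step \<alpha> x \<phi> i) (argmin F))\<^sup>2"
  let ?R = "2 * \<alpha>\<^sup>2 * grad_variance xs \<phi> - 2 * \<alpha> * (1 - 2 * \<alpha> * L) * (F x - (INF y. F y))"
  have "?S / real n - ?R \<le> (infdist x (argmin F))\<^sup>2"
  proof (rule le_infdist_power2[OF argmin])
    fix z assume z: "z \<in> argmin F"
    have "?S \<le> (\<Sum>i=1..n. (norm (iterate_step \<alpha> x \<phi> i - z))\<^sup>2)"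
      using z by (intro sum_mono power_mono) (auto simp: infdist_nonneg dist_norm[symmetric] infdist_le)
    also have "\<dots> \<le> real n * ((norm (x - z))\<^sup>2 + ?R)"
      using sum_norm_iterate_step_le[OF \<alpha> z, of x \<phi>]
      by (simp add: Inf_F[OF z] grad_variance_argmin[OF xs z] algebra_simps)
    finally show "?S / real n - ?R \<le> (dist x z)\<^sup>2"
      using n by (simp add: dist_norm field_simps)
  qed
  thus ?thesis using n by (simp add: field_simps)
qed

text \<open>A draw refreshes one of the \<open>n\<close> summands. On average a fraction
  \<open>1 / n\<close> of the variance is exchanged for gradient differences at \<open>x\<close>,
  which cocoercivity bounds by the gap.\<close>

lemma sum_grad_variance_memory_step_le:
  assumes xs: "xs \<in> argmin F"
  shows "(\<Sum>i=1..n. grad_variance xs (memory_step x \<phi> i))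
    \<le> (real n - 1) * grad_variance xs \<phi> + 2 * L * (F x - (INF y. F y))"
proof -
  define a where "a j = (norm (grad (f j) (\<phi> j) - grad (f j) xs))\<^sup>2" for j
  define b where "b j = (norm (grad (f j) x - grad (f j) xs))\<^sup>2" for j
  have a: "(\<Sum>j=1..n. a j) = real n * grad_variance xs \<phi>"
    unfolding grad_variance_def a_def using n by (simp del: One_nat_def)
  have "grad_variance xs (memory_step x \<phi> i) = grad_variance xs \<phi> + 1 / real n * (b i - a i)"
    if "i \<in> {1..n}" for i
  proof -
    have "(\<Sum>j=1..n. (norm (grad (f j) (memory_step x \<phi> i j) - grad (f j) xs))\<^sup>2)
        = (\<Sum>j=1..n. a j + (if j = i then b i - a i else 0))"
      by (intro sum.cong) (auto simp: memory_step_def a_def b_def)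
    also have "\<dots> = (\<Sum>j=1..n. a j) + (b i - a i)"
      using that by (simp add: sum.distrib)
    finally have "grad_variance xs (memory_step x \<phi> i) = 1 / real n * (real n * grad_variance xs \<phi> + (b i - a i))"
      unfolding grad_variance_def[of _ "memory_step x \<phi> i"] a by simp
    thus ?thesis using n by (simp add: distrib_left)
  qed
  hence "(\<Sum>i=1..n. grad_variance xs (memory_step x \<phi> i))
      = (\<Sum>i=1..n. grad_variance xs \<phi> + 1 / real n * (b i - a i))"
    by (intro sum.cong) auto
  also have "\<dots> = real n * grad_variance xs \<phi> + 1 / real n * ((\<Sum>i=1..n. b i) - (\<Sum>i=1..n. a i))"
    by (simp only: sum.distrib sum_distrib_left[symmetric] sum_subtractf) simp
  also have "\<dots> \<le> real n * grad_variance xs \<phi>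
      + 1 / real n * (2 * L * real n * (F x - (INF y. F y)) - real n * grad_variance xs \<phi>)"
    unfolding a b_def Inf_F[OF xs] using sum_norm_grad_diff_le[OF xs, of x]
    by (intro add_left_mono mult_left_mono diff_right_mono) simp_all
  also have "\<dots> = (real n - 1) * grad_variance xs \<phi> + 2 * L * (F x - (INF y. F y))"
    using n by (simp add: right_diff_distrib left_diff_distrib)
  finally show ?thesis .
qed

lemma lyapunov_contraction:
  assumes \<mu>: "\<mu> > 0" and PL: "polyak_lojasiewicz \<mu> F" and M: "M > 0"
    and \<alpha>: "\<alpha> > 0" "\<alpha> * L * (2 + M / real n) \<le> 1" and xs: "xs \<in> argmin F"
  defines "q \<equiv> max (1 - \<alpha> * \<mu> * (1 - \<alpha> * L * (2 + M / real n))) (1 + 2 / M - 1 / real n)"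
  shows "1 / real n * (\<Sum>i=1..n. lyapunov \<alpha> M xs (iterate_step \<alpha> x \<phi> i) (memory_step x \<phi> i))
    \<le> q * lyapunov \<alpha> M xs x \<phi>"
proof -
  define \<kappa> where "\<kappa> = 1 - \<alpha> * L * (2 + M / real n)"
  have \<kappa>: "\<kappa> \<ge> 0" using \<alpha> by (simp add: \<kappa>_def)
  define D where "D = F x - (INF y. F y)"
  define d where "d = (infdist x (argmin F))\<^sup>2"
  define v where "v = grad_variance xs \<phi>"
  have v: "v \<ge> 0" by (simp add: v_def grad_variance_nonneg)
  have "\<alpha> * L * 2 \<le> \<alpha> * L * (2 + M / real n)"
    using \<alpha> L M by (intro mult_left_mono) auto
  hence \<alpha>L: "\<alpha> * L < 1" using \<alpha> by linarith
  have "(\<Sum>i=1..n. lyapunov \<alpha> M xs (iterate_step \<alpha> x \<phi> i) (memory_step x \<phi> i))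
      = (\<Sum>i=1..n. (infdist (iterate_step \<alpha> x \<phi> i) (argmin F))\<^sup>2)
        + \<alpha>\<^sup>2 * M * (\<Sum>i=1..n. grad_variance xs (memory_step x \<phi> i))"
    by (simp add: lyapunov_def sum.distrib sum_distrib_left)
  also have "\<dots> \<le> real n * (d - 2 * \<alpha> * (1 - 2 * \<alpha> * L) * D + 2 * \<alpha>\<^sup>2 * v)
        + \<alpha>\<^sup>2 * M * ((real n - 1) * v + 2 * L * D)"
    unfolding d_def D_def v_def using M
    by (intro add_mono mult_left_mono sum_infdist_iterate_step_le[OF \<alpha>(1) \<alpha>L xs]
          sum_grad_variance_memory_step_le[OF xs]) auto
  \<comment> \<open>The memory refresh adds \<open>\<alpha>\<^sup>2 * M * 2 * L * D\<close>, which
    lowers \<open>1 - 2 * \<alpha> * L\<close> to \<open>\<kappa>\<close>. The noise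
    \<open>2 * \<alpha>\<^sup>2 * v\<close> is the fraction \<open>2 / M\<close> of the weighted
    variance.\<close>
  also have "\<dots> = real n * (d - 2 * \<alpha> * \<kappa> * D + (1 + 2 / M - 1 / real n) * (\<alpha>\<^sup>2 * M * v))"
    using n M by (simp add: \<kappa>_def field_simps power2_eq_square)
  also have "\<dots> \<le> real n * ((1 - \<alpha> * \<mu> * \<kappa>) * d + (1 + 2 / M - 1 / real n) * (\<alpha>\<^sup>2 * M * v))"
  proof -
    have "2 * \<alpha> * \<kappa> * (\<mu> / 2 * d) \<le> 2 * \<alpha> * \<kappa> * D"
      unfolding d_def D_def using \<alpha> \<kappa> by (intro mult_left_mono quadratic_growth_F[OF \<mu> PL]) auto
    hence "d - 2 * \<alpha> * \<kappa> * D \<le> (1 - \<alpha> * \<mu> * \<kappa>) * d"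
      by (simp add: algebra_simps)
    thus ?thesis by (intro mult_left_mono add_right_mono) auto
  qed
  also have "\<dots> \<le> real n * (q * d + q * (\<alpha>\<^sup>2 * M * v))"
    using M v by (intro mult_left_mono add_mono mult_right_mono) (auto simp: q_def \<kappa>_def d_def)
  finally show ?thesis
    using n by (simp add: lyapunov_def d_def v_def field_simps)
qed

end

section \<open>Uniform independent draws\<close>

context prob_space
begin

context
  fixes ix :: "nat \<Rightarrow> 'a \<Rightarrow> 'i" and S :: "'i set"
  assumes S: "finite S" "S \<noteq> {}"
    and indep: "indep_vars (\<lambda>_. count_space S) ix UNIV"
    and uniform: "\<And>k. distr M (count_space S) (ix k) = uniform_count_measure S"
begin

lemma measurable_uniform_index [measurable]: "ix k \<in> measurable M (count_space S)"
  using indep by (auto simp: indep_vars_def)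

lemma uniform_index_in: "\<omega> \<in> space M \<Longrightarrow> ix k \<omega> \<in> S"
  using measurable_space[OF measurable_uniform_index] by simp

text \<open>\<open>restrict\<close> makes histories extensional, so that they range over the finite
  set \<open>{..<k} \<rightarrow>\<^sub>E S\<close>.\<close>

definition history :: "nat \<Rightarrow> 'a \<Rightarrow> nat \<Rightarrow> 'i" where
  "history k \<omega> = restrict (\<lambda>j. ix j \<omega>) {..<k}"

lemma history_in: "\<omega> \<in> space M \<Longrightarrow> history k \<omega> \<in> {..<k} \<rightarrow>\<^sub>E S"
  by (auto simp: history_def uniform_index_in)

lemma history_vimage:
  assumes "s \<in> {..<k} \<rightarrow>\<^sub>E S"
  shows "history k -` {s} \<inter> space M = space M \<inter> (\<Inter>j<k. ix j -` {s j} \<inter> space M)"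
proof -
  have "history k \<omega> = s \<longleftrightarrow> (\<forall>j<k. ix j \<omega> = s j)" for \<omega>
    using assms by (auto simp: history_def fun_eq_iff PiE_def extensional_def)
  thus ?thesis by auto
qed

lemma history_event:
  assumes s: "s \<in> {..<k} \<rightarrow>\<^sub>E S"
  shows "history k -` {s} \<inter> space M \<in> events"
proof (cases "k = 0")
  case False
  have "ix j -` {s j} \<inter> space M \<in> events" if "j < k" for j
    by (rule measurable_sets[OF measurable_uniform_index]) (use s that in auto)
  thus ?thesis
    unfolding history_vimage[OF s]
    by (intro sets.Int[OF sets.top sets.finite_INT]) (use False in auto)
qed (use history_vimage[OF s] in simp)

lemma prob_history:
  assumes s: "s \<in> {..<k} \<rightarrow>\<^sub>E S"
  shows "prob (history k -` {s} \<inter> space M) = (1 / real (card S)) ^ k"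
proof (cases "k = 0")
  case True
  thus ?thesis unfolding history_vimage[OF s] by (simp add: prob_space)
next
  case False
  have sj: "s j \<in> S" if "j < k" for j using s that by auto
  have single: "prob (ix j -` {s j} \<inter> space M) = 1 / real (card S)" if "j < k" for j
  proof -
    have "prob (ix j -` {s j} \<inter> space M) = measure (distr M (count_space S) (ix j)) {s j}"
      by (rule measure_distr[symmetric]) (use sj[OF that] in auto)
    thus ?thesis
      using sj[OF that] S by (simp add: uniform measure_uniform_count_measure)
  qed
  have "prob (history k -` {s} \<inter> space M) = prob (\<Inter>j<k. ix j -` {s j} \<inter> space M)"
    unfolding history_vimage[OF s] using False by (intro arg_cong[of _ _ prob]) auto
  also have "\<dots> = (\<Prod>j<k. prob (ix j -` {s j} \<inter> space M))"
    by (rule indep_varsD[OF indep]) (use False sj in auto)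
  also have "\<dots> = (1 / real (card S)) ^ k" using single by simp
  finally show ?thesis .
qed

text \<open>A function of the history is, on the sample space, a finite combination of indicators of
  equally likely events. This settles integrability and the expectation at once.\<close>

lemma has_expectation_history:
  fixes Y :: "'a \<Rightarrow> real"
  assumes Y: "\<And>\<omega>. \<omega> \<in> space M \<Longrightarrow> Y \<omega> = y (history k \<omega>)"
  shows "integrable M Y"
    and "expectation Y = (1 / real (card S)) ^ k * (\<Sum>s\<in>{..<k} \<rightarrow>\<^sub>E S. y s)"
proof -
  define Z where "Z \<omega> = (\<Sum>s\<in>{..<k} \<rightarrow>\<^sub>E S. y s * indicator (history k -` {s} \<inter> space M) \<omega>)" for \<omega>
  have fin: "finite ({..<k} \<rightarrow>\<^sub>E S)" using S by (intro finite_PiE) auto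
  have YZ: "Y \<omega> = Z \<omega>" if "\<omega> \<in> space M" for \<omega>
  proof -
    have "Z \<omega> = (\<Sum>s\<in>{..<k} \<rightarrow>\<^sub>E S. if s = history k \<omega> then y s else 0)"
      unfolding Z_def by (intro sum.cong) (use that in \<open>auto simp: indicator_def\<close>)
    thus ?thesis using fin history_in[OF that] Y[OF that] by simp
  qed
  have int: "integrable M (\<lambda>\<omega>. y s * indicator (history k -` {s} \<inter> space M) \<omega>)"
    if "s \<in> {..<k} \<rightarrow>\<^sub>E S" for s
    using history_event[OF that] by (intro integrable_mult_right) (auto simp: less_top[symmetric])
  hence "integrable M Z" unfolding Z_def by (rule Bochner_Integration.integrable_sum)
  thus "integrable M Y" using Bochner_Integration.integrable_cong[OF refl YZ, of M "\<lambda>\<omega>. \<omega>"] by simp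
  have "expectation Y = expectation Z" by (rule Bochner_Integration.integral_cong[OF refl YZ])
  also have "\<dots> = (\<Sum>s\<in>{..<k} \<rightarrow>\<^sub>E S. expectation (\<lambda>\<omega>. y s * indicator (history k -` {s} \<inter> space M) \<omega>))"
    unfolding Z_def by (rule Bochner_Integration.integral_sum[OF int])
  also have "\<dots> = (\<Sum>s\<in>{..<k} \<rightarrow>\<^sub>E S. y s * (1 / real (card S)) ^ k)"
    by (intro sum.cong) (auto simp: prob_history Int_absorb2 Int_assoc)
  finally show "expectation Y = (1 / real (card S)) ^ k * (\<Sum>s\<in>{..<k} \<rightarrow>\<^sub>E S. y s)"
    by (simp only: sum_distrib_right[symmetric] mult.commute)
qed

text \<open>The factor \<open>h\<close> evaluates \<open>X\<close> at a chosen sample point with the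
  given history; the choice does not matter by \<open>det\<close>.\<close>

lemma history_determined:
  assumes det: "\<And>\<omega> \<omega>'. \<omega> \<in> space M \<Longrightarrow> \<omega>' \<in> space M \<Longrightarrow> (\<And>j. j < k \<Longrightarrow> ix j \<omega> = ix j \<omega>') \<Longrightarrow> X \<omega> = X \<omega>'"
  obtains h where "\<And>\<omega>. \<omega> \<in> space M \<Longrightarrow> X \<omega> = h (history k \<omega>)"
proof
  fix \<omega> assume \<omega>: "\<omega> \<in> space M"
  let ?\<omega>' = "SOME \<omega>'. \<omega>' \<in> space M \<and> history k \<omega>' = history k \<omega>"
  have *: "?\<omega>' \<in> space M \<and> history k ?\<omega>' = history k \<omega>"
    by (rule someI[of _ \<omega>]) (simp add: \<omega>)
  have "ix j ?\<omega>' = ix j \<omega>" if "j < k" for j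
    using fun_cong[OF conjunct2[OF *], of j] that by (simp add: history_def)
  thus "X \<omega> = (\<lambda>s. X (SOME \<omega>'. \<omega>' \<in> space M \<and> history k \<omega>' = s)) (history k \<omega>)"
    using det[of \<omega> ?\<omega>'] * \<omega> by metis
qed

text \<open>An elementary form of conditioning on the first \<open>k\<close> draws: the next index
  is averaged out while the state is kept. The state may have any type, because only finitely many
  histories occur.\<close>

lemma
  fixes g :: "'s \<Rightarrow> 'i \<Rightarrow> real"
  assumes det: "\<And>\<omega> \<omega>'. \<omega> \<in> space M \<Longrightarrow> \<omega>' \<in> space M \<Longrightarrow> (\<And>j. j < k \<Longrightarrow> ix j \<omega> = ix j \<omega>') \<Longrightarrow> X \<omega> = X \<omega>'"
  shows integrable_determined: "integrable M (\<lambda>\<omega>. r (X \<omega>) :: real)"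
    and expectation_uniform_next: "expectation (\<lambda>\<omega>. g (X \<omega>) (ix k \<omega>))
      = expectation (\<lambda>\<omega>. 1 / real (card S) * (\<Sum>i\<in>S. g (X \<omega>) i))"
proof -
  obtain h where h: "\<And>\<omega>. \<omega> \<in> space M \<Longrightarrow> X \<omega> = h (history k \<omega>)"
    by (rule history_determined[of k X]) (use det in blast)+
  show "integrable M (\<lambda>\<omega>. r (X \<omega>))"
    by (rule has_expectation_history(1)[of _ "\<lambda>s. r (h s)" k]) (simp add: h)
  let ?N = "{..<k} \<rightarrow>\<^sub>E S" and ?c = "1 / real (card S)"
  let ?e = "\<lambda>(i, s). s(k := i)"
  \<comment> \<open>A history of length \<open>Suc k\<close> is a history of length \<open>k\<close>
    together with the index drawn at step \<open>k\<close>.\<close>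
  have bij: "bij_betw ?e (S \<times> ?N) ({..<Suc k} \<rightarrow>\<^sub>E S)"
    unfolding bij_betw_def lessThan_Suc PiE_insert_eq
    by (intro conjI inj_combinator) auto
  have h': "X \<omega> = h (restrict (history (Suc k) \<omega>) {..<k})" if "\<omega> \<in> space M" for \<omega>
  proof -
    have "restrict (history (Suc k) \<omega>) {..<k} = history k \<omega>"
      by (auto simp: history_def fun_eq_iff)
    thus ?thesis using h[OF that] by simp
  qed
  have "expectation (\<lambda>\<omega>. g (X \<omega>) (ix k \<omega>))
      = ?c ^ Suc k * (\<Sum>s\<in>{..<Suc k} \<rightarrow>\<^sub>E S. g (h (restrict s {..<k})) (s k))"
    by (rule has_expectation_history(2)) (simp add: h' , simp add: history_def)
  also have "(\<Sum>s\<in>{..<Suc k} \<rightarrow>\<^sub>E S. g (h (restrict s {..<k})) (s k))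
      = (\<Sum>p\<in>S \<times> ?N. g (h (restrict (?e p) {..<k})) (?e p k))"
    by (rule sum.reindex_bij_betw[OF bij, symmetric])
  also have "\<dots> = (\<Sum>(i, s)\<in>S \<times> ?N. g (h s) i)"
  proof (intro sum.cong refl, clarify)
    fix i s assume "s \<in> ?N"
    hence "restrict (s(k := i)) {..<k} = s"
      by (auto simp: fun_eq_iff PiE_def extensional_def)
    thus "g (h (restrict (s(k := i)) {..<k})) ((s(k := i)) k) = g (h s) i" by simp
  qed
  also have "(\<Sum>(i, s)\<in>S \<times> ?N. g (h s) i) = (\<Sum>s\<in>?N. \<Sum>i\<in>S. g (h s) i)"
    by (subst sum.cartesian_product[symmetric]) (rule sum.swap)
  also have "?c ^ Suc k * \<dots> = ?c ^ k * (\<Sum>s\<in>?N. ?c * (\<Sum>i\<in>S. g (h s) i))"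
    by (simp add: sum_distrib_left mult_ac)
  also have "\<dots> = expectation (\<lambda>\<omega>. ?c * (\<Sum>i\<in>S. g (X \<omega>) i))"
    by (rule has_expectation_history(2)[symmetric]) (simp add: h)
  finally show "expectation (\<lambda>\<omega>. g (X \<omega>) (ix k \<omega>)) = expectation (\<lambda>\<omega>. ?c * (\<Sum>i\<in>S. g (X \<omega>) i))" .
qed

end

end

section \<open>Convergence of SAPA\<close>

theorem corollary4p19:
  fixes n :: nat
    and f :: "nat \<Rightarrow> 'a::{real_inner, complete_space, second_countable_topology} \<Rightarrow> real"
    and F :: "'a \<Rightarrow> real"
    and L \<mu> \<alpha> M q :: real
    and P :: "'w measure"
    and ix :: "nat \<Rightarrow> 'w \<Rightarrow> nat"
    and x0 :: 'a
    and x :: "nat \<Rightarrow> 'w \<Rightarrow> 'a"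
    and \<phi> :: "nat \<Rightarrow> nat \<Rightarrow> 'w \<Rightarrow> 'a"
  assumes n: "n \<ge> 1"
    and F: "F = (\<lambda>y. 1 / real n * (\<Sum>i=1..n. f i y))"
    and argmin: "argmin F \<noteq> {}"
    and L: "L > 0"
    and convex: "\<And>i. i \<in> {1..n} \<Longrightarrow> convex_on UNIV (f i)"
    and smooth: "\<And>i. i \<in> {1..n} \<Longrightarrow> L_smooth L (f i)"
    and mu: "\<mu> > 0"
    and PL: "polyak_lojasiewicz \<mu> F"
    and P: "prob_space P"
    and indep: "prob_space.indep_vars P (\<lambda>_. count_space {1..n}) ix UNIV"
    and uniform: "\<And>k. distr P (count_space {1..n}) (ix k) = uniform_count_measure {1..n}"
    and sapa: "\<And>\<omega>. \<omega> \<in> space P \<Longrightarrow>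
      sapa \<alpha> n f x0 (\<lambda>k. ix k \<omega>) (\<lambda>k. x k \<omega>) (\<lambda>k i. \<phi> k i \<omega>)"
    and M: "M > 2 * real n"
    and alpha: "\<alpha> > 0" "\<alpha> < 1 / (L * (2 + M / real n))"
    and q: "q = max (1 - \<alpha> * \<mu> * (1 - \<alpha> * L * (2 + M / real n))) (1 + 2 / M - 1 / real n)"
  shows "q \<in> {0<..<1} \<and>
    (\<forall>xs \<in> argmin F. norm (x0 - xs) = infdist x0 (argmin F) \<longrightarrow>
      (let \<sigma>0_sq = (\<lambda>\<omega>. 1 / real n *
             (\<Sum>i=1..n. (norm (grad (f i) (\<phi> 0 i \<omega>) - grad (f i) xs))\<^sup>2));
           C = (infdist x0 (argmin F))\<^sup>2 + \<alpha>\<^sup>2 * M * prob_space.expectation P \<sigma>0_sq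
       in \<forall>k. prob_space.expectation P (\<lambda>\<omega>. (infdist (x k \<omega>) (argmin F))\<^sup>2) \<le> q ^ k * C \<and>
              prob_space.expectation P (\<lambda>\<omega>. F (x k \<omega>) - (INF z. F z)) \<le> q ^ k * L / 2 * C))"
proof -
  interpret P: prob_space P by (rule P)
  interpret finite_sum_problem n f F L
    by unfold_locales (use n F argmin L convex smooth in auto)
  note S = finite_atLeastAtMost[of 1 n]
  have Sne: "{1..n} \<noteq> {}" using n by simp
  note chance = S Sne indep uniform
  have ix: "ix k \<omega> \<in> {1..n}" if "\<omega> \<in> space P" for k \<omega>
    using P.uniform_index_in[OF chance that] .
  \<comment> \<open>Here \<open>M > 2 * real n\<close> enters: it pushes the second entry of the
    maximum below 1.\<close>
  have Mpos: "M > 0" "2 / M < 1 / real n" using M n by (auto simp: field_simps)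
  have pos: "L * (2 + M / real n) > 0"
    using L Mpos n by (intro mult_pos_pos add_pos_nonneg) auto
  have \<alpha>: "\<alpha> * L * (2 + M / real n) < 1"
    using alpha(2) pos by (simp add: pos_less_divide_eq mult.assoc)
  have \<alpha>\<mu>: "\<alpha> * \<mu> * (1 - \<alpha> * L * (2 + M / real n)) > 0"
    using alpha(1) mu \<alpha> by simp
  have "1 / real n \<le> 1" "2 / M > 0" using n Mpos by simp_all
  hence "0 < 1 + 2 / M - 1 / real n" "1 + 2 / M - 1 / real n < 1"
    using Mpos(2) by linarith+
  \<comment> \<open>Positivity comes from the second entry of the maximum alone, whereas
    \<open>q < 1\<close> needs both entries.\<close>
  hence q01: "0 < q" "q < 1"
    using \<alpha>\<mu> by (auto simp only: q less_max_iff_disj max_less_iff_conj)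

  \<comment> \<open>\<open>sapa\<close> says nothing about \<open>\<phi>\<close> outside
    \<open>{1..n}\<close>; only the restricted memory is determined by the draws.\<close>
  define X where "X k \<omega> = (x k \<omega>, restrict (\<lambda>i. \<phi> k i \<omega>) {1..n})" for k \<omega>
  have init: "x 0 \<omega> = x0" "i \<in> {1..n} \<Longrightarrow> \<phi> 0 i \<omega> = x0"
    and step_x: "x (Suc k) \<omega> = iterate_step \<alpha> (x k \<omega>) (\<lambda>i. \<phi> k i \<omega>) (ix k \<omega>)"
    and step_\<phi>: "i \<in> {1..n} \<Longrightarrow> \<phi> (Suc k) i \<omega> = memory_step (x k \<omega>) (\<lambda>i. \<phi> k i \<omega>) (ix k \<omega>) i"
    if "\<omega> \<in> space P" for \<omega> k i
    using sapa[OF that] by (auto simp: sapa_def iterate_step_def memory_step_def)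
  have iterate_restrict: "iterate_step \<alpha> u (restrict \<psi> {1..n}) i = iterate_step \<alpha> u \<psi> i"
    if "i \<in> {1..n}" for u \<psi> i
    using that by (simp add: iterate_step_def)
  have memory_restrict: "memory_step u (restrict \<psi> {1..n}) i j = memory_step u \<psi> i j"
    if "j \<in> {1..n}" for u \<psi> i j
    using that by (simp add: memory_step_def)
  have step: "x (Suc k) \<omega> = iterate_step \<alpha> (fst (X k \<omega>)) (snd (X k \<omega>)) (ix k \<omega>)"
    "i \<in> {1..n} \<Longrightarrow> \<phi> (Suc k) i \<omega> = memory_step (fst (X k \<omega>)) (snd (X k \<omega>)) (ix k \<omega>) i"
    if "\<omega> \<in> space P" for \<omega> k i
    using ix[OF that] step_x[OF that] step_\<phi>[OF that]
    by (simp_all only: X_def fst_conv snd_conv iterate_restrict memory_restrict)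
  have det: "X k \<omega> = X k \<omega>'"
    if "\<omega> \<in> space P" "\<omega>' \<in> space P" "\<And>j. j < k \<Longrightarrow> ix j \<omega> = ix j \<omega>'" for k \<omega> \<omega>'
    using that
  proof (induction k)
    case 0
    thus ?case by (auto simp: X_def init fun_eq_iff)
  next
    case (Suc k)
    hence eq: "X k \<omega> = X k \<omega>'" "ix k \<omega> = ix k \<omega>'" by auto
    have "x (Suc k) \<omega> = x (Suc k) \<omega>'"
      "i \<in> {1..n} \<Longrightarrow> \<phi> (Suc k) i \<omega> = \<phi> (Suc k) i \<omega>'" for i
      using Suc.prems(1,2) by (simp_all only: step eq)
    thus ?case by (auto simp: X_def fun_eq_iff)
  qed
  have int: "integrable P (\<lambda>\<omega>. r (X k \<omega>) :: real)" for r k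
    by (rule P.integrable_determined[OF chance det])

  have bound: "P.expectation (\<lambda>\<omega>. (infdist (x k \<omega>) (argmin F))\<^sup>2) \<le> q ^ k * C"
    if xs: "xs \<in> argmin F"
      and C: "C = (infdist x0 (argmin F))\<^sup>2 + \<alpha>\<^sup>2 * M * P.expectation (\<lambda>\<omega>. grad_variance xs (\<lambda>i. \<phi> 0 i \<omega>))"
    for k xs C
  proof -
    define V where "V = (\<lambda>(u, \<psi>). lyapunov \<alpha> M xs u \<psi>)"
    have lyapunov_cong: "lyapunov \<alpha> M xs u \<psi> = lyapunov \<alpha> M xs u \<psi>'"
      if "\<And>i. i \<in> {1..n} \<Longrightarrow> \<psi> i = \<psi>' i" for u \<psi> \<psi>'
      using that by (simp add: lyapunov_def grad_variance_def)
    have VX: "V (X k \<omega>) = lyapunov \<alpha> M xs (x k \<omega>) (\<lambda>i. \<phi> k i \<omega>)" for k \<omega>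
      unfolding V_def X_def prod.case by (rule lyapunov_cong) simp
    define g where "g = (\<lambda>(u, \<psi>) i. lyapunov \<alpha> M xs (iterate_step \<alpha> u \<psi> i) (memory_step u \<psi> i))"
    have next_V: "V (X (Suc k) \<omega>) = g (X k \<omega>) (ix k \<omega>)" if "\<omega> \<in> space P" for k \<omega>
      unfolding VX g_def case_prod_unfold step(1)[OF that]
      by (rule lyapunov_cong) (rule step(2)[OF that])
    have contract: "1 / real n * (\<Sum>i=1..n. g s i) \<le> q * V s" for s
      unfolding g_def V_def q case_prod_unfold
      by (rule lyapunov_contraction[OF mu PL Mpos(1) alpha(1) less_imp_le[OF \<alpha>] xs])
    have EV: "P.expectation (\<lambda>\<omega>. V (X k \<omega>)) \<le> q ^ k * C" for k
    proof (induction k)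
      \<comment> \<open>All stored points equal \<open>x0\<close> initially, so both expectations
        are those of constants.\<close>
      case 0
      have "V (X 0 \<omega>) = (infdist x0 (argmin F))\<^sup>2 + \<alpha>\<^sup>2 * M * grad_variance xs (\<lambda>_. x0)"
        if "\<omega> \<in> space P" for \<omega>
        unfolding VX using init[OF that] by (simp add: lyapunov_def grad_variance_def)
      moreover have "grad_variance xs (\<lambda>i. \<phi> 0 i \<omega>) = grad_variance xs (\<lambda>_. x0)"
        if "\<omega> \<in> space P" for \<omega>
        using init[OF that] by (simp add: grad_variance_def)
      ultimately show ?case
        by (simp add: C P.prob_space cong: Bochner_Integration.integral_cong)
    next
      case (Suc k)
      have "P.expectation (\<lambda>\<omega>. V (X (Suc k) \<omega>)) = P.expectation (\<lambda>\<omega>. g (X k \<omega>) (ix k \<omega>))"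
        by (rule Bochner_Integration.integral_cong[OF refl next_V])
      also have "\<dots> = P.expectation (\<lambda>\<omega>. 1 / real (card {1..n}) * (\<Sum>i=1..n. g (X k \<omega>) i))"
        by (rule P.expectation_uniform_next[OF chance det])
      also have "\<dots> \<le> P.expectation (\<lambda>\<omega>. q * V (X k \<omega>))"
        by (rule integral_mono[OF int int]) (use contract in simp)
      also have "\<dots> = q * P.expectation (\<lambda>\<omega>. V (X k \<omega>))"
        by simp
      also have "\<dots> \<le> q * (q ^ k * C)"
        using Suc q01 by (intro mult_left_mono) auto
      finally show ?case by (simp add: mult.assoc)
    qed
    have "P.expectation (\<lambda>\<omega>. (infdist (fst (X k \<omega>)) (argmin F))\<^sup>2) \<le> P.expectation (\<lambda>\<omega>. V (X k \<omega>))"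
    proof (rule integral_mono[OF int int])
      show "(infdist (fst (X k \<omega>)) (argmin F))\<^sup>2 \<le> V (X k \<omega>)" for \<omega>
        using grad_variance_nonneg Mpos(1) by (simp add: V_def lyapunov_def case_prod_unfold)
    qed
    thus ?thesis using EV[of k] by (simp add: X_def)
  qed
  have gap: "P.expectation (\<lambda>\<omega>. F (x k \<omega>) - (INF z. F z))
      \<le> L / 2 * P.expectation (\<lambda>\<omega>. (infdist (x k \<omega>) (argmin F))\<^sup>2)" for k
  proof -
    have "P.expectation (\<lambda>\<omega>. F (fst (X k \<omega>)) - (INF z. F z))
        \<le> P.expectation (\<lambda>\<omega>. L / 2 * (infdist (fst (X k \<omega>)) (argmin F))\<^sup>2)"
      by (rule integral_mono[OF int int]) (rule F_gap_le)
    thus ?thesis by (simp add: X_def)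
  qed
  show ?thesis
    \<comment> \<open>Folding identifies \<open>\<sigma>0_sq\<close> with
      \<open>grad_variance xs\<close> at the initial memory.\<close>
    unfolding Let_def grad_variance_def[symmetric]
  proof (intro conjI ballI impI allI)
    show "q \<in> {0<..<1}" using q01 by simp
    fix xs k
    let ?C = "(infdist x0 (argmin F))\<^sup>2 + \<alpha>\<^sup>2 * M * P.expectation (\<lambda>\<omega>. grad_variance xs (\<lambda>i. \<phi> 0 i \<omega>))"
    assume xs: "xs \<in> argmin F"
    show dist: "P.expectation (\<lambda>\<omega>. (infdist (x k \<omega>) (argmin F))\<^sup>2) \<le> q ^ k * ?C"
      by (rule bound[OF xs refl])
    show "P.expectation (\<lambda>\<omega>. F (x k \<omega>) - (INF z. F z)) \<le> q ^ k * L / 2 * ?C"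
      using order_trans[OF gap mult_left_mono[OF dist, of "L / 2"]] L by (simp add: mult_ac)
  qed
qed

end
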